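(* Let $D\subset\mathbb C^n$ be a domain, $\mu\in\mathcal M^+(D)$ a nonzero measure, $p\in(0,+\infty)$, and let $w\colon D\to\mathbb R$ be a function for which the integral $\int_D e^{-pw}\,d\mu$ exists, is finite and is nonzero. For $f\in\operatorname{Hol}(D)$ put $$\|f\|_{p;w}:=\left(\frac{1}{\int_D e^{-pw}\,d\mu}\int_D|f|^pe^{-pw}\,d\mu\right)^{1/p},\qquad \|f\|_{+\infty;w}:=\sup_{z\in D}\bigl(|f(z)|e^{-w(z)}\bigr).$$ Let $0,\mathsf z\in D$, and let $\mathfrak a=\mathfrak a_0^{\mathsf z}\colon D\to D$ be a holomorphic map such that: $\mathfrak a_0^{\mathsf z}$ is $\mu$-measurable and $\mu\bigl((\mathfrak a_0^{\mathsf z})^{-1}K\bigr)<+\infty$ for every compact $K\subset D$; $\mathfrak a_0^{\mathsf z}(0)=\mathsf z$; the measure $\mu$ is invariant under $\mathfrak a_0^{\mathsf z}$, i.e. $\mathfrak a_0^{\mathsf z}\mu=\mu$; and $$\exp(w-w\circ\mathfrak a_0^{\mathsf z})\in|\operatorname{Hol}(D)|:=\{|\varphi|:\varphi\in\operatorname{Hol}(D)\}.$$ Then for $f\in\operatorname{Hol}(D)$ with $\|f\|_{p;w}<+\infty$ the following estimate holds: $$|f(\mathsf z)|e^{-w(\mathsf z)}\le\|\delta_0\|^*_{p;w}\cdot\|f\|_{p;w}\cdot e^{-w(0)},\qquad\text{where}\quad \|\delta_0\|^*_{p;w}:=\sup_{\substack{\varphi\in\operatorname{Hol}(D)\\ 0<\|\varphi\|_{p;w}<+\infty}}\frac{|\varphi(0)|}{\|\varphi\|_{p;w}}.$$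 If $\varphi\mapsto\varphi\circ\mathfrak a_0^{\mathsf z}$ is a surjection of $\operatorname{Hol}(D)$ onto $\operatorname{Hol}(D)$, then this estimate is sharp. If such a map $\mathfrak a_0^{\mathsf z}$ exists for each point $\mathsf z\in D$, then for all $p\in(0,+\infty)$ the estimate $$\|f\|_{+\infty;w}\le\|\delta_0\|^*_{p;w}\cdot\|f\|_{p;w}\cdot e^{-w(0)}$$ is unimprovable.
   Context: A domain is a nonempty connected open set. $\operatorname{Hol}(D)$ is the complex vector space of all holomorphic functions on $D$. $\mathcal M^+(D)$ is the cone of positive Borel (Radon) measures on $D$. For a $\mu$-measurable map $\mathfrak a\colon D\to D$ with $\mu(\mathfrak a^{-1}K)<+\infty$ for all compact $K\subset D$ (where $\mathfrak a^{-1}K$ is the preimage of $K$), the image measure $\mathfrak a\mu\in\mathcal M^+(D)$ is defined by $(\mathfrak a\mu)(K)=\mu(\mathfrak a^{-1}K)$ for compact $K\subset D$. The quantity $\|f\|_{p;w}$ is considered under the standing condition that $\int_D e^{-pw}\,d\mu$ is finite and nonzero. "Sharp" and "unimprovable" mean that the constant $\|\delta_0\|^*_{p;w}e^{-w(0)}$ in the corresponding estimate cannot be replaced by a smaller one. *)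

theory Defs
  imports "HOL-Analysis.Analysis"
begin

definition domain :: "(complex ^ 'n) set \<Rightarrow> bool" where
  "domain D \<longleftrightarrow> D \<noteq> {} \<and> open D \<and> connected D"

(* Functions on D are total functions of which only the values on D matter; accordingly
   statements about elements of Hol D compare them pointwise on D. *)
definition Hol :: "(complex ^ 'n) set \<Rightarrow> (complex ^ 'n \<Rightarrow> complex) set" where
  "Hol D = {f. \<forall>x\<in>D. \<exists>f'. (f has_derivative f') (at x) \<and> (\<forall>c v. f' (c *s v) = c * f' v)}"

definition Hol_self_maps :: "(complex ^ 'n) set \<Rightarrow> (complex ^ 'n \<Rightarrow> complex ^ 'n) set" where
  "Hol_self_maps D = {a. a ` D \<subseteq> D \<and> (\<forall>i. (\<lambda>x. a x $ i) \<in> Hol D)}"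

(* For an open subset of a Euclidean space, a Borel measure is Radon iff it is finite on
   compact sets. *)
definition radon_measures :: "(complex ^ 'n) set \<Rightarrow> (complex ^ 'n) measure set" where
  "radon_measures D = {\<mu>. sets \<mu> = sets (restrict_space borel D) \<and>
     (\<forall>K. compact K \<and> K \<subseteq> D \<longrightarrow> emeasure \<mu> K < \<infinity>)}"

(* Mu-measurability is measurability with respect to the completion of mu. *)
definition proper_measurable ::
    "(complex ^ 'n) set \<Rightarrow> (complex ^ 'n) measure \<Rightarrow> (complex ^ 'n \<Rightarrow> complex ^ 'n) \<Rightarrow> bool" where
  "proper_measurable D \<mu> a \<longleftrightarrow>
     a \<in> measurable (completion \<mu>) (restrict_space borel D) \<and>
     (\<forall>K. compact K \<and> K \<subseteq> D \<longrightarrow> emeasure (completion \<mu>) (a -` K \<inter> D) < \<infinity>)"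

(* For proper_measurable maps this push-forward is the element of radon_measures D whose value
   at every compact K is the measure of the preimage of K; a Radon measure on D is determined
   by its values on compact sets. *)
definition image_measure ::
    "(complex ^ 'n) set \<Rightarrow> (complex ^ 'n \<Rightarrow> complex ^ 'n) \<Rightarrow> (complex ^ 'n) measure \<Rightarrow> (complex ^ 'n) measure"
  where "image_measure D a \<mu> = distr (completion \<mu>) (restrict_space borel D) a"

definition admissible_weight ::
    "(complex ^ 'n) measure \<Rightarrow> (complex ^ 'n \<Rightarrow> real) \<Rightarrow> real \<Rightarrow> bool" where
  "admissible_weight \<mu> w p \<longleftrightarrow>
     integrable (completion \<mu>) (\<lambda>x. exp (- p * w x)) \<and>
     (LINT x|completion \<mu>. exp (- p * w x)) \<noteq> 0"

definition ennreal_powr :: "ennreal \<Rightarrow> real \<Rightarrow> ennreal" where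
  "ennreal_powr x r = (if x = \<infinity> then \<infinity> else ennreal (enn2real x powr r))"

definition weighted_norm ::
    "(complex ^ 'n) measure \<Rightarrow> (complex ^ 'n \<Rightarrow> real) \<Rightarrow> real \<Rightarrow> (complex ^ 'n \<Rightarrow> complex) \<Rightarrow> ennreal"
  where
  "weighted_norm \<mu> w p f =
     ennreal_powr
       (ennreal (1 / (LINT x|completion \<mu>. exp (- p * w x))) *
        (\<integral>\<^sup>+ x. ennreal (cmod (f x) powr p * exp (- p * w x)) \<partial>completion \<mu>))
       (1 / p)"

definition weighted_sup_norm ::
    "(complex ^ 'n) set \<Rightarrow> (complex ^ 'n \<Rightarrow> real) \<Rightarrow> (complex ^ 'n \<Rightarrow> complex) \<Rightarrow> ennreal" where
  "weighted_sup_norm D w f = (SUP x\<in>D. ennreal (cmod (f x) * exp (- w x)))"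

definition delta0_norm ::
    "(complex ^ 'n) set \<Rightarrow> (complex ^ 'n) measure \<Rightarrow> (complex ^ 'n \<Rightarrow> real) \<Rightarrow> real \<Rightarrow> ennreal" where
  "delta0_norm D \<mu> w p =
     (SUP \<phi> \<in> {\<phi> \<in> Hol D. 0 < weighted_norm \<mu> w p \<phi> \<and> weighted_norm \<mu> w p \<phi> < \<infinity>}.
        ennreal (cmod (\<phi> 0)) / weighted_norm \<mu> w p \<phi>)"

(* An estimate with an infinite constant is void, so a constant \<infinity> times a norm is \<infinity>.
   The measure-theoretic convention \<infinity> * 0 = 0 is not the intended one here: if mu is supported
   on a lattice, some nonzero f in Hol D have weighted_norm 0. *)
definition const_times :: "ennreal \<Rightarrow> ennreal \<Rightarrow> ennreal" (infixl "\<odot>" 70) where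
  "C \<odot> x = (if C = \<infinity> then \<infinity> else C * x)"

definition transport_map ::
    "(complex ^ 'n) set \<Rightarrow> (complex ^ 'n) measure \<Rightarrow> (complex ^ 'n \<Rightarrow> real) \<Rightarrow> complex ^ 'n \<Rightarrow>
     (complex ^ 'n \<Rightarrow> complex ^ 'n) \<Rightarrow> bool" where
  "transport_map D \<mu> w z a \<longleftrightarrow>
     a \<in> Hol_self_maps D \<and>
     proper_measurable D \<mu> a \<and>
     a 0 = z \<and>
     image_measure D a \<mu> = \<mu> \<and>
     (\<exists>\<phi>\<in>Hol D. \<forall>x\<in>D. exp (w x - w (a x)) = cmod (\<phi> x))"

definition composition_surjective ::
    "(complex ^ 'n) set \<Rightarrow> (complex ^ 'n \<Rightarrow> complex ^ 'n) \<Rightarrow> bool" where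
  "composition_surjective D a \<longleftrightarrow> (\<forall>g\<in>Hol D. \<exists>f\<in>Hol D. \<forall>x\<in>D. f (a x) = g x)"

(* The constant in L f \<le> C * weighted_norm f, where f ranges over the elements of Hol D of
   finite weighted norm, cannot be replaced by a smaller one. *)
definition unimprovable ::
    "(complex ^ 'n) set \<Rightarrow> (complex ^ 'n) measure \<Rightarrow> (complex ^ 'n \<Rightarrow> real) \<Rightarrow> real \<Rightarrow>
     ((complex ^ 'n \<Rightarrow> complex) \<Rightarrow> ennreal) \<Rightarrow> ennreal \<Rightarrow> bool" where
  "unimprovable D \<mu> w p L C \<longleftrightarrow>
     (\<forall>C' < C. \<not> (\<forall>f\<in>Hol D. weighted_norm \<mu> w p f < \<infinity> \<longrightarrow> L f \<le> C' * weighted_norm \<mu> w p f))"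

end

theory Submission
  imports Defs
begin

text \<open>If the modulus of a holomorphic function \<open>\<phi>\<close> is \<open>exp (w - w \<circ> a)\<close>, then invariance of \<open>\<mu>\<close> makes
  \<open>f \<mapsto> \<phi> \<cdot> (f \<circ> a)\<close> an isometry for the weighted norm which turns evaluation at \<open>z = a 0\<close> into evaluation
  at 0, up to the weights. It is onto when composition with \<open>a\<close> is, because \<open>\<phi>\<close> has no zeros.
  For the supremum norm the point 0 alone already witnesses optimality of the constant.\<close>

section \<open>Algebra and composition of holomorphic functions\<close>

lemma Hol_const: "(\<lambda>_. c) \<in> Hol (D :: (complex ^ 'n) set)"
proof -
  have "((\<lambda>_. c) has_derivative (\<lambda>_. 0)) (at x)" for x :: "complex ^ 'n"
    by (rule has_derivative_const)
  then show ?thesis unfolding Hol_def by (intro CollectI ballI exI[where x = "\<lambda>_. 0"]) simp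
qed

lemma Hol_add:
  assumes "f \<in> Hol D" "g \<in> Hol D"
  shows "(\<lambda>x. f x + g x) \<in> Hol D"
  unfolding Hol_def mem_Collect_eq
proof
  fix x assume "x \<in> D"
  with assms obtain f' g' where
    "(f has_derivative f') (at x)" "\<forall>c v. f' (c *s v) = c * f' v"
    "(g has_derivative g') (at x)" "\<forall>c v. g' (c *s v) = c * g' v"
    unfolding Hol_def by blast
  then show "\<exists>h'. ((\<lambda>x. f x + g x) has_derivative h') (at x) \<and> (\<forall>c v. h' (c *s v) = c * h' v)"
    by (intro exI[of _ "\<lambda>v. f' v + g' v"]) (auto intro!: has_derivative_add simp: algebra_simps)
qed

lemma Hol_mult:
  assumes "f \<in> Hol D" "g \<in> Hol D"
  shows "(\<lambda>x. f x * g x) \<in> Hol D"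
  unfolding Hol_def mem_Collect_eq
proof
  fix x assume "x \<in> D"
  with assms obtain f' g' where
    "(f has_derivative f') (at x)" "\<forall>c v. f' (c *s v) = c * f' v"
    "(g has_derivative g') (at x)" "\<forall>c v. g' (c *s v) = c * g' v"
    unfolding Hol_def by blast
  then show "\<exists>h'. ((\<lambda>x. f x * g x) has_derivative h') (at x) \<and> (\<forall>c v. h' (c *s v) = c * h' v)"
    by (intro exI[of _ "\<lambda>v. f x * g' v + f' v * g x"])
       (auto intro!: has_derivative_mult simp: algebra_simps)
qed

lemma Hol_inverse:
  assumes "f \<in> Hol D" "\<And>x. x \<in> D \<Longrightarrow> f x \<noteq> 0"
  shows "(\<lambda>x. inverse (f x)) \<in> Hol D"
  unfolding Hol_def mem_Collect_eq
proof
  fix x assume x: "x \<in> D"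
  with assms(1) obtain f' where
    f': "(f has_derivative f') (at x)" "\<forall>c v. f' (c *s v) = c * f' v"
    unfolding Hol_def by blast
  show "\<exists>h'. ((\<lambda>x. inverse (f x)) has_derivative h') (at x) \<and> (\<forall>c v. h' (c *s v) = c * h' v)"
    using f' assms(2)[OF x]
    by (intro exI[of _ "\<lambda>v. - (inverse (f x) * f' v * inverse (f x))"])
       (auto intro!: Deriv.has_derivative_inverse)
qed

text \<open>Chain rule: the coordinates of \<open>a\<close> have complex-linear derivatives, these
  assemble into a derivative of the vector-valued map, and complex linearity survives composition
  with \<open>f'\<close>.\<close>

lemma Hol_comp:
  fixes D :: "(complex ^ 'n) set"
  assumes f: "f \<in> Hol D" and a: "a \<in> Hol_self_maps D"
  shows "(\<lambda>x. f (a x)) \<in> Hol D"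
  unfolding Hol_def mem_Collect_eq
proof
  fix x assume x: "x \<in> D"
  then have "a x \<in> D" using a by (auto simp: Hol_self_maps_def)
  with f obtain f' where
    f': "(f has_derivative f') (at (a x))" "\<forall>c v. f' (c *s v) = c * f' v"
    unfolding Hol_def by blast
  have "\<forall>i. \<exists>A. ((\<lambda>x. a x $ i) has_derivative A) (at x) \<and> (\<forall>c v. A (c *s v) = c * A v)"
    using a x by (auto simp: Hol_self_maps_def Hol_def)
  then obtain A where A: "\<And>i. ((\<lambda>x. a x $ i) has_derivative A i) (at x)"
      "\<And>i c v. A i (c *s v) = c * A i v"
    by metis
  \<comment> \<open>Inserting a coordinate by \<open>axis i\<close> is bounded linear, so
    \<open>a\<close>, as the sum of its inserted coordinates, is differentiable as a map into the
    vector space.\<close>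
  have "bounded_linear (axis i :: complex \<Rightarrow> complex ^ 'n)" for i
    unfolding linear_conv_bounded_linear[symmetric]
    by (rule linearI) (simp_all add: axis_def vec_eq_iff)
  from bounded_linear.has_derivative[OF this A(1)]
  have "((\<lambda>x. \<Sum>i\<in>UNIV. axis i (a x $ i)) has_derivative (\<lambda>v. \<Sum>i\<in>UNIV. axis i (A i v))) (at x)"
    by (intro has_derivative_sum)
  moreover have axis_sum: "(\<Sum>i\<in>UNIV. axis i (u i)) = (\<chi> i. u i)" for u :: "'n \<Rightarrow> complex"
    by (simp add: vec_eq_iff axis_def)
  ultimately have "(a has_derivative (\<lambda>v. \<chi> i. A i v)) (at x)"
    by (simp add: axis_sum)
  from has_derivative_compose[OF this f'(1)]
  have "((\<lambda>x. f (a x)) has_derivative (\<lambda>v. f' (\<chi> i. A i v))) (at x)" .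
  moreover have "(\<chi> i. A i (c *s v)) = c *s (\<chi> i. A i v)" for c v
    by (simp add: A(2) vec_eq_iff)
  ultimately show "\<exists>h'. ((\<lambda>x. f (a x)) has_derivative h') (at x) \<and> (\<forall>c v. h' (c *s v) = c * h' v)"
    using f'(2) by (intro exI[of _ "\<lambda>v. f' (\<chi> i. A i v)"]) auto
qed

section \<open>Measurability and change of variables for the completed measure\<close>

lemma Hol_measurable:
  assumes "f \<in> Hol D" "sets \<mu> = sets (restrict_space borel D)"
  shows "f \<in> borel_measurable (completion \<mu>)"
proof -
  have "continuous_on D f"
    using assms(1) unfolding Hol_def
    by (intro continuous_at_imp_continuous_on) (auto intro: has_derivative_continuous)
  then have "f \<in> borel_measurable (restrict_space borel D)"
    by (rule borel_measurable_continuous_on_restrict)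
  then have "f \<in> borel_measurable \<mu>"
    using measurable_cong_sets[OF assms(2) refl] by blast
  then show ?thesis by (rule measurable_completion)
qed

text \<open>The change of variables for \<open>distr\<close> requires measurability on
  \<open>N\<close>, whereas \<open>h\<close> is measurable only for the completion. Hence
  \<open>h\<close> is replaced by an almost everywhere equal \<open>h'\<close> that is measurable
  for \<open>M\<close> itself.\<close>

lemma nn_integral_completion_distr_invariant:
  fixes h :: "'a \<Rightarrow> ennreal"
  assumes a: "a \<in> measurable (completion M) N" and inv: "distr (completion M) N a = M"
    and h: "h \<in> borel_measurable (completion M)"
  shows "(\<integral>\<^sup>+ x. h (a x) \<partial>completion M) = (\<integral>\<^sup>+ x. h x \<partial>completion M)"
proof -
  obtain h' where h': "h' \<in> borel_measurable M" and ae: "AE x in M. h x = h' x"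
    using completion_ex_borel_measurable[OF h] by blast
  have "sets N = sets M" using inv by (metis sets_distr)
  then have h'N: "h' \<in> borel_measurable N"
    using h' measurable_cong_sets[OF _ refl] by blast
  \<comment> \<open>By invariance the exceptional set is null for the image measure as well, so its
    preimage under \<open>a\<close> is null.\<close>
  have "AE x in distr (completion M) N a. h x = h' x" using ae by (simp only: inv)
  then have "AE x in completion M. h (a x) = h' (a x)" by (rule AE_distrD[OF a])
  then have "(\<integral>\<^sup>+ x. h (a x) \<partial>completion M) = (\<integral>\<^sup>+ x. h' (a x) \<partial>completion M)"
    by (rule nn_integral_cong_AE)
  also have "\<dots> = (\<integral>\<^sup>+ x. h' x \<partial>distr (completion M) N a)"
    by (rule nn_integral_distr[symmetric, OF a]) (simp add: h'N)
  also have "\<dots> = (\<integral>\<^sup>+ x. h' x \<partial>completion M)"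
    using h' by (simp add: inv nn_integral_completion)
  also have "\<dots> = (\<integral>\<^sup>+ x. h x \<partial>completion M)"
    using AE_completion[OF ae] by (intro nn_integral_cong_AE) auto
  finally show ?thesis .
qed

section \<open>The weighted norm and its invariance under transport\<close>

lemma weighted_norm_cong_AE:
  assumes "AE x in completion \<mu>. cmod (f x) = cmod (g x)"
  shows "weighted_norm \<mu> w p f = weighted_norm \<mu> w p g"
proof -
  have "(\<integral>\<^sup>+ x. ennreal (cmod (f x) powr p * exp (- p * w x)) \<partial>completion \<mu>)
      = (\<integral>\<^sup>+ x. ennreal (cmod (g x) powr p * exp (- p * w x)) \<partial>completion \<mu>)"
    using assms by (intro nn_integral_cong_AE) auto
  then show ?thesis by (simp add: weighted_norm_def)
qed

lemma admissible_weight_pos: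
  assumes "admissible_weight \<mu> w p"
  shows "(LINT x|completion \<mu>. exp (- p * w x)) > 0"
  using assms Bochner_Integration.integral_nonneg[of "completion \<mu>" "\<lambda>x. exp (- p * w x)"]
  by (auto simp: admissible_weight_def order_less_le)

lemma weighted_norm_one:
  assumes "admissible_weight \<mu> w p"
  shows "weighted_norm \<mu> w p (\<lambda>_. 1) = 1"
proof -
  let ?I = "LINT x|completion \<mu>. exp (- p * w x)"
  have "(\<integral>\<^sup>+ x. ennreal (exp (- p * w x)) \<partial>completion \<mu>) = ennreal ?I"
    using assms by (intro nn_integral_eq_integral) (auto simp: admissible_weight_def)
  then show ?thesis
    using admissible_weight_pos[OF assms]
    by (simp add: weighted_norm_def ennreal_powr_def flip: ennreal_mult'')
qed

lemma weighted_norm_eq_0D: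
  assumes adm: "admissible_weight \<mu> w p" and f: "f \<in> Hol D"
    and sets: "sets \<mu> = sets (restrict_space borel D)"
    and 0: "weighted_norm \<mu> w p f = 0"
  shows "AE x in completion \<mu>. f x = 0"
proof -
  let ?h = "\<lambda>x. ennreal (cmod (f x) powr p * exp (- p * w x))"
  \<comment> \<open>Any exponent is allowed: \<open>powr\<close> vanishes only at base 0, and the
    value at infinity is infinite.\<close>
  have powr0: "x = 0" if "ennreal_powr x r = 0" for x r
    using that by (cases x) (auto simp: ennreal_powr_def split: if_splits)
  have [measurable]: "(\<lambda>x. exp (- p * w x)) \<in> borel_measurable (completion \<mu>)"
    using adm by (auto simp: admissible_weight_def)
  note [measurable] = Hol_measurable[OF f sets]
  have "?h \<in> borel_measurable (completion \<mu>)" by measurable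
  moreover have "(\<integral>\<^sup>+ x. ?h x \<partial>completion \<mu>) = 0"
    using powr0[OF 0[unfolded weighted_norm_def]] admissible_weight_pos[OF adm] by auto
  ultimately have "AE x in completion \<mu>. ?h x = 0"
    using nn_integral_0_iff_AE by blast
  then show ?thesis
    by eventually_elim (auto simp: ennreal_eq_0_iff mult_le_0_iff)
qed

text \<open>The p-th power of exp (w - w o a) turns the weight exp (-p w) into exp (-p (w o a)). The
  integrand of \<open>g\<close> thus becomes that of \<open>f\<close> composed with
  \<open>a\<close>, and invariance removes \<open>a\<close>. Only the modulus of \<open>g\<close> on
  \<open>D\<close> enters, so the lemma serves both to push \<open>f\<close> forward in the estimate
  and to compare a given \<psi> with its preimage in the proof of sharpness.\<close>

lemma weighted_norm_transport:
  assumes sets: "sets \<mu> = sets (restrict_space borel D)"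
    and adm: "admissible_weight \<mu> w p"
    and T: "transport_map D \<mu> w z a" and f: "f \<in> Hol D"
    and g: "\<And>x. x \<in> D \<Longrightarrow> cmod (g x) = exp (w x - w (a x)) * cmod (f (a x))"
  shows "weighted_norm \<mu> w p g = weighted_norm \<mu> w p f"
proof -
  let ?h = "\<lambda>x. ennreal (cmod (f x) powr p * exp (- p * w x))"
  have sp: "space \<mu> = D" using sets_eq_imp_space_eq[OF sets] by (simp add: space_restrict_space)
  have [measurable]: "(\<lambda>x. exp (- p * w x)) \<in> borel_measurable (completion \<mu>)"
    using adm by (auto simp: admissible_weight_def)
  note [measurable] = Hol_measurable[OF f sets]
  have h: "?h \<in> borel_measurable (completion \<mu>)" by measurable
  have "ennreal (cmod (g x) powr p * exp (- p * w x)) = ?h (a x)" if "x \<in> D" for x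
  proof -
    have "cmod (g x) powr p * exp (- p * w x)
        = exp (p * (w x - w (a x))) * exp (- p * w x) * cmod (f (a x)) powr p"
      by (simp add: g[OF that] powr_mult exp_powr_real mult_ac)
    also have "exp (p * (w x - w (a x))) * exp (- p * w x) = exp (- p * w (a x))"
      by (simp add: algebra_simps flip: exp_add)
    finally show ?thesis by (simp add: mult_ac)
  qed
  then have "(\<integral>\<^sup>+ x. ennreal (cmod (g x) powr p * exp (- p * w x)) \<partial>completion \<mu>)
      = (\<integral>\<^sup>+ x. ?h (a x) \<partial>completion \<mu>)"
    by (intro nn_integral_cong) (simp add: sp)
  also have "\<dots> = (\<integral>\<^sup>+ x. ?h x \<partial>completion \<mu>)"
    using T h unfolding transport_map_def proper_measurable_def image_measure_def
    by (intro nn_integral_completion_distr_invariant) auto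
  finally show ?thesis by (simp add: weighted_norm_def)
qed

section \<open>Evaluation at 0\<close>

lemma delta0_norm_ge_1:
  assumes "admissible_weight \<mu> w p"
  shows "1 \<le> delta0_norm D \<mu> w p"
proof -
  \<comment> \<open>The test function is the constant 1, which the normalising factor gives norm
    1.\<close>
  have "ennreal (cmod 1) / weighted_norm \<mu> w p (\<lambda>_. 1) \<le> delta0_norm D \<mu> w p"
    unfolding delta0_norm_def
    by (rule SUP_upper[where f = "\<lambda>\<phi>. ennreal (cmod (\<phi> 0)) / weighted_norm \<mu> w p \<phi>"])
       (simp add: Hol_const weighted_norm_one[OF assms])
  then show ?thesis by (simp add: weighted_norm_one[OF assms] divide_ennreal_def)
qed

text \<open>For positive norm this is the definition of the supremum. Functions of norm 0 are absent
  from that supremum and need their own argument: with a finite constant the bound then says that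
  \<open>g\<close> vanishes at 0.\<close>

lemma delta0_norm_estimate:
  assumes sets: "sets \<mu> = sets (restrict_space borel D)"
    and adm: "admissible_weight \<mu> w p"
    and g: "g \<in> Hol D" and fin: "weighted_norm \<mu> w p g < \<infinity>"
  shows "ennreal (cmod (g 0)) \<le> delta0_norm D \<mu> w p \<odot> weighted_norm \<mu> w p g"
proof (cases "delta0_norm D \<mu> w p = \<infinity>")
  case True
  then show ?thesis by (simp add: const_times_def)
next
  case finite: False
  show ?thesis
  proof (cases "weighted_norm \<mu> w p g = 0")
    case False
    then have "ennreal (cmod (g 0)) / weighted_norm \<mu> w p g \<le> delta0_norm D \<mu> w p"
      using g fin unfolding delta0_norm_def by (intro SUP_upper) (auto simp: zero_less_iff_neq_zero)
    then have "ennreal (cmod (g 0)) / weighted_norm \<mu> w p g * weighted_norm \<mu> w p g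
        \<le> delta0_norm D \<mu> w p * weighted_norm \<mu> w p g"
      by (rule mult_right_mono) simp
    also have "ennreal (cmod (g 0)) / weighted_norm \<mu> w p g * weighted_norm \<mu> w p g = ennreal (cmod (g 0))"
      using False fin by (simp add: ennreal_divide_times ennreal_mult_divide_eq)
    finally show ?thesis using finite by (simp add: const_times_def)
  next
    case True
    \<comment> \<open>Adding multiples of g to the constant 1 does not change its norm, so if g did not vanish
      at 0 the norm of the evaluation functional would be infinite.\<close>
    have ae: "AE x in completion \<mu>. g x = 0" by (rule weighted_norm_eq_0D[OF adm g sets True])
    have bound: "ennreal (cmod (1 + c * g 0)) \<le> delta0_norm D \<mu> w p" for c
    proof -
      have "weighted_norm \<mu> w p (\<lambda>x. 1 + c * g x) = weighted_norm \<mu> w p (\<lambda>_. 1)"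
        using ae by (intro weighted_norm_cong_AE) auto
      then have 1: "weighted_norm \<mu> w p (\<lambda>x. 1 + c * g x) = 1"
        by (simp add: weighted_norm_one[OF adm])
      have "(\<lambda>x. 1 + c * g x) \<in> Hol D" by (intro Hol_add Hol_mult Hol_const g)
      then show ?thesis unfolding delta0_norm_def
        by (intro SUP_upper2[of "\<lambda>x. 1 + c * g x"]) (auto simp: 1 divide_ennreal_def)
    qed
    have "g 0 = 0"
    proof (rule ccontr)
      assume "g 0 \<noteq> 0"
      \<comment> \<open>The multiplier c = (n - 1) / g 0 makes 1 + c * g 0 equal to n.\<close>
      then have ge: "of_nat n \<le> delta0_norm D \<mu> w p" for n
        using bound[of "(of_nat n - 1) / g 0"] by (simp add: ennreal_of_nat_eq_real_of_nat)
      from finite obtain n where "delta0_norm D \<mu> w p < of_nat n"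
        using ennreal_Ex_less_of_nat[of "delta0_norm D \<mu> w p"] by (auto simp: top.not_eq_extremum)
      with ge[of n] show False by simp
    qed
    then show ?thesis by simp
  qed
qed

text \<open>This is the common core of both sharpness claims. The supremum, possibly infinite, need
  not be attained, but anything strictly below it is exceeded by the quotient of some
  \<psi>.\<close>

lemma delta0_norm_unimprovable:
  assumes "C' < delta0_norm D \<mu> w p * ennreal (exp (- w 0))"
  obtains \<psi> where "\<psi> \<in> Hol D" "weighted_norm \<mu> w p \<psi> < \<infinity>"
    "C' * weighted_norm \<mu> w p \<psi> < ennreal (cmod (\<psi> 0) * exp (- w 0))"
proof -
  let ?N = "weighted_norm \<mu> w p"
  have "C' < (SUP \<phi>\<in>{\<phi> \<in> Hol D. 0 < ?N \<phi> \<and> ?N \<phi> < \<infinity>}.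
     ennreal (cmod (\<phi> 0)) / ?N \<phi> * ennreal (exp (- w 0)))"
    using assms by (simp add: delta0_norm_def SUP_mult_right_ennreal)
  then obtain \<psi> where \<psi>: "\<psi> \<in> Hol D" "0 < ?N \<psi>" "?N \<psi> < \<infinity>"
      "C' < ennreal (cmod (\<psi> 0)) / ?N \<psi> * ennreal (exp (- w 0))"
    by (auto simp: less_SUP_iff)
  \<comment> \<open>Strictness survives the multiplication, and the quotient cancels, because the
    norm of \<psi> is positive and finite.\<close>
  have "C' * ?N \<psi> < ennreal (cmod (\<psi> 0)) / ?N \<psi> * ennreal (exp (- w 0)) * ?N \<psi>"
    using \<psi> by (intro ennreal_mult_strict_right_mono) auto
  also have "\<dots> = ennreal (cmod (\<psi> 0)) / ?N \<psi> * ?N \<psi> * ennreal (exp (- w 0))"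
    by (simp add: mult_ac)
  also have "ennreal (cmod (\<psi> 0)) / ?N \<psi> * ?N \<psi> = ennreal (cmod (\<psi> 0))"
    using \<psi> by (simp add: ennreal_divide_times ennreal_mult_divide_eq)
  also have "ennreal (cmod (\<psi> 0)) * ennreal (exp (- w 0)) = ennreal (cmod (\<psi> 0) * exp (- w 0))"
    by (simp add: ennreal_mult)
  finally show ?thesis using \<psi> that by blast
qed

section \<open>Transport of the estimate between 0 and z\<close>

lemma transport_estimate:
  assumes sets: "sets \<mu> = sets (restrict_space borel D)"
    and adm: "admissible_weight \<mu> w p" and "0 \<in> D"
    and T: "transport_map D \<mu> w z a"
    and f: "f \<in> Hol D" and fin: "weighted_norm \<mu> w p f < \<infinity>"
  shows "ennreal (cmod (f z) * exp (- w z))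
           \<le> delta0_norm D \<mu> w p \<odot> weighted_norm \<mu> w p f * ennreal (exp (- w 0))"
proof -
  obtain \<phi> where \<phi>: "\<phi> \<in> Hol D" "\<And>x. x \<in> D \<Longrightarrow> exp (w x - w (a x)) = cmod (\<phi> x)"
    using T by (auto simp: transport_map_def)
  have a: "a \<in> Hol_self_maps D" "a 0 = z" using T by (auto simp: transport_map_def)
  \<comment> \<open>The modulus of \<open>g\<close> at 0 is exp (w 0 - w z) * cmod (f z), so the
    factor exp (- w 0) leaves exactly the weighted value of \<open>f\<close> at
    \<open>z\<close>.\<close>
  define g where "g x = \<phi> x * f (a x)" for x
  have g: "g \<in> Hol D" unfolding g_def by (rule Hol_mult[OF \<phi>(1) Hol_comp[OF f a(1)]])
  have norm_g: "weighted_norm \<mu> w p g = weighted_norm \<mu> w p f"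
    by (rule weighted_norm_transport[OF sets adm T f]) (simp add: g_def norm_mult \<phi>(2))
  have "cmod (f z) * exp (- w z) = cmod (g 0) * exp (- w 0)"
    by (simp add: g_def norm_mult \<phi>(2)[OF \<open>0 \<in> D\<close>, symmetric] a(2) exp_diff exp_minus field_simps)
  then have "ennreal (cmod (f z) * exp (- w z)) = ennreal (cmod (g 0)) * ennreal (exp (- w 0))"
    by (simp add: ennreal_mult)
  also have "\<dots> \<le> delta0_norm D \<mu> w p \<odot> weighted_norm \<mu> w p g * ennreal (exp (- w 0))"
    using delta0_norm_estimate[OF sets adm g] fin by (intro mult_right_mono) (auto simp: norm_g)
  finally show ?thesis by (simp add: norm_g)
qed

text \<open>Here the transport is inverted: a near-extremal \<psi> for evaluation at 0 has the form
  \<phi> * (f o a) on \<open>D\<close>, and \<open>f\<close> is then equally near-extremal for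
  evaluation at \<open>z\<close>.\<close>

lemma transport_unimprovable:
  assumes sets: "sets \<mu> = sets (restrict_space borel D)"
    and adm: "admissible_weight \<mu> w p" and "0 \<in> D"
    and T: "transport_map D \<mu> w z a" and surj: "composition_surjective D a"
  shows "unimprovable D \<mu> w p (\<lambda>f. ennreal (cmod (f z) * exp (- w z)))
           (delta0_norm D \<mu> w p * ennreal (exp (- w 0)))"
  unfolding unimprovable_def
proof (intro allI impI)
  fix C' assume "C' < delta0_norm D \<mu> w p * ennreal (exp (- w 0))"
  then obtain \<psi> where \<psi>: "\<psi> \<in> Hol D" "weighted_norm \<mu> w p \<psi> < \<infinity>"
    "C' * weighted_norm \<mu> w p \<psi> < ennreal (cmod (\<psi> 0) * exp (- w 0))"
    by (rule delta0_norm_unimprovable)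
  obtain \<phi> where \<phi>: "\<phi> \<in> Hol D" "\<And>x. x \<in> D \<Longrightarrow> exp (w x - w (a x)) = cmod (\<phi> x)"
    using T by (auto simp: transport_map_def)
  have a: "a 0 = z" using T by (auto simp: transport_map_def)
  have nz: "\<phi> x \<noteq> 0" if "x \<in> D" for x using \<phi>(2)[OF that] by auto
  \<comment> \<open>Division is possible since the modulus of \<phi> is an exponential; surjectivity
    is then applied to the quotient.\<close>
  have "(\<lambda>x. \<psi> x * inverse (\<phi> x)) \<in> Hol D" by (intro Hol_mult Hol_inverse \<psi>(1) \<phi>(1) nz)
  from bspec[OF surj[unfolded composition_surjective_def] this]
  obtain f where f: "f \<in> Hol D" "\<And>x. x \<in> D \<Longrightarrow> f (a x) = \<psi> x * inverse (\<phi> x)"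
    by auto
  have \<psi>_eq: "cmod (\<psi> x) = exp (w x - w (a x)) * cmod (f (a x))" if "x \<in> D" for x
    using nz[OF that] by (simp add: \<phi>(2)[OF that] f(2)[OF that] norm_mult norm_inverse)
  have norm_f: "weighted_norm \<mu> w p \<psi> = weighted_norm \<mu> w p f"
    by (rule weighted_norm_transport[OF sets adm T f(1) \<psi>_eq])
  have "cmod (f z) * exp (- w z) = cmod (\<psi> 0) * exp (- w 0)"
    using \<psi>_eq[OF \<open>0 \<in> D\<close>] a by (simp add: exp_diff exp_minus field_simps)
  with \<psi> f(1) norm_f
  show "\<not> (\<forall>f\<in>Hol D. weighted_norm \<mu> w p f < \<infinity> \<longrightarrow>
           ennreal (cmod (f z) * exp (- w z)) \<le> C' * weighted_norm \<mu> w p f)"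
    by (auto simp: not_le intro!: bexI[of _ f])
qed

section \<open>The supremum norm\<close>

lemma sup_norm_estimate:
  assumes sets: "sets \<mu> = sets (restrict_space borel D)"
    and adm: "admissible_weight \<mu> w p" and "0 \<in> D"
    and ex: "\<forall>z\<in>D. \<exists>a. transport_map D \<mu> w z a" and f: "f \<in> Hol D"
  shows "weighted_sup_norm D w f
           \<le> delta0_norm D \<mu> w p \<odot> weighted_norm \<mu> w p f * ennreal (exp (- w 0))"
proof (cases "weighted_norm \<mu> w p f < \<infinity>")
  case True
  show ?thesis unfolding weighted_sup_norm_def
    using ex transport_estimate[OF sets adm \<open>0 \<in> D\<close> _ f True] by (intro SUP_least) blast
next
  case False
  \<comment> \<open>For a function of infinite norm the right-hand side is infinite as soon as the
    constant is nonzero.\<close>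
  moreover have "delta0_norm D \<mu> w p \<noteq> 0" using delta0_norm_ge_1[OF adm, of D] by auto
  ultimately show ?thesis
    by (simp add: const_times_def not_less ennreal_mult_top ennreal_top_mult top_unique ennreal_mult_eq_top_iff)
qed

lemma sup_norm_unimprovable:
  assumes "0 \<in> D"
  shows "unimprovable D \<mu> w p (weighted_sup_norm D w)
           (delta0_norm D \<mu> w p * ennreal (exp (- w 0)))"
  unfolding unimprovable_def
proof (intro allI impI)
  fix C' assume "C' < delta0_norm D \<mu> w p * ennreal (exp (- w 0))"
  then obtain \<psi> where \<psi>: "\<psi> \<in> Hol D" "weighted_norm \<mu> w p \<psi> < \<infinity>"
    "C' * weighted_norm \<mu> w p \<psi> < ennreal (cmod (\<psi> 0) * exp (- w 0))"
    by (rule delta0_norm_unimprovable)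
  note \<psi>(3)
  also have "ennreal (cmod (\<psi> 0) * exp (- w 0)) \<le> weighted_sup_norm D w \<psi>"
    unfolding weighted_sup_norm_def using assms by (rule SUP_upper)
  finally show "\<not> (\<forall>f\<in>Hol D. weighted_norm \<mu> w p f < \<infinity> \<longrightarrow>
      weighted_sup_norm D w f \<le> C' * weighted_norm \<mu> w p f)"
    using \<psi> by (auto simp: not_le intro!: bexI[of _ \<psi>])
qed

theorem mainTheorem2:
  fixes D :: "(complex ^ 'n) set"
    and \<mu> :: "(complex ^ 'n) measure"
    and w :: "complex ^ 'n \<Rightarrow> real"
    and p :: real
  assumes "domain D"
    and "\<mu> \<in> radon_measures D"
    and "emeasure \<mu> D \<noteq> 0"
    and "p > 0"
    and "admissible_weight \<mu> w p"
    and "0 \<in> D"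
  shows
    "(\<forall>z\<in>D. \<forall>a. transport_map D \<mu> w z a \<longrightarrow>
        (\<forall>f\<in>Hol D. weighted_norm \<mu> w p f < \<infinity> \<longrightarrow>
           ennreal (cmod (f z) * exp (- w z))
             \<le> delta0_norm D \<mu> w p \<odot> weighted_norm \<mu> w p f * ennreal (exp (- w 0))) \<and>
        (composition_surjective D a \<longrightarrow>
           unimprovable D \<mu> w p (\<lambda>f. ennreal (cmod (f z) * exp (- w z)))
             (delta0_norm D \<mu> w p * ennreal (exp (- w 0))))) \<and>
     ((\<forall>z\<in>D. \<exists>a. transport_map D \<mu> w z a) \<longrightarrow>
        (\<forall>q>0. admissible_weight \<mu> w q \<longrightarrow>
           (\<forall>f\<in>Hol D. weighted_sup_norm D w f
              \<le> delta0_norm D \<mu> w q \<odot> weighted_norm \<mu> w q f * ennreal (exp (- w 0))) \<and>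
           unimprovable D \<mu> w q (weighted_sup_norm D w)
             (delta0_norm D \<mu> w q * ennreal (exp (- w 0)))))"
proof -
  have sets: "sets \<mu> = sets (restrict_space borel D)"
    using assms(2) by (simp add: radon_measures_def)
  \<comment> \<open>\<open>transport_map\<close> involves no exponent, so the same maps serve every
    admissible \<open>q\<close>; the admissibility premise of \<open>sup_norm_estimate\<close> is
    therefore left open.\<close>
  show ?thesis
    using transport_estimate[OF sets \<open>admissible_weight \<mu> w p\<close> \<open>0 \<in> D\<close>]
      transport_unimprovable[OF sets \<open>admissible_weight \<mu> w p\<close> \<open>0 \<in> D\<close>]
      sup_norm_estimate[OF sets _ \<open>0 \<in> D\<close>] sup_norm_unimprovable[OF \<open>0 \<in> D\<close>]
    by blast
qed

end
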